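(* Let $(\prec_t,\succ_t,\curlyvee_t)$ be a formal one-parameter deformation of an NS-algebra $A=(A,\prec,\succ,\curlyvee)$. Then the linear term $\pi_1=(\prec_1,\succ_1,\curlyvee_1)$ is a $2$-cocycle in the cohomology of the NS-algebra $A$, whose cohomology class in $H^2_{\mathrm{NS}}(A,A)$ depends only on the equivalence class of the deformation $(\prec_t,\succ_t,\curlyvee_t)$.
   Context: All vector spaces and linear maps are over a field $\mathbb K$ of characteristic $0$. An NS-algebra is a vector space $A$ with bilinear operations $\prec,\succ,\curlyvee$ such that, with $a*b=a\prec b+a\succ b+a\curlyvee b$, for all $a,b,c$: $(a\prec b)\prec c=a\prec(b*c)$; $(a\succ b)\prec c=a\succ(b\prec c)$; $(a*b)\succ c=a\succ(b\succ c)$; $(a\curlyvee b)\prec c+(a*b)\curlyvee c=a\succ(b\curlyvee c)+a\curlyvee(b*c)$. A morphism is a linear map preserving the three operations. The operad $\mathcal O_A$: $C_1=\{[1]\}$, $C_n=\{[1],\ldots,[n],[n+1]\}$ for $n\ge2$, $\mathcal O_A(n)=\mathrm{Hom}(\mathbb K[C_n]\otimes A^{\otimes n},A)$, with values $f([r];a_1,\ldots,a_n)$ extended linearly in the first argument; for $f\in\mathcal O_A(1)$, $f([2];\cdot)$ is read as $0$. For $f\in\mathcal O_A(m)$, $g\in\mathcal O_A(n)$, $1\le i\le m$, write $g_{s}=g(s;a_i,\ldots,a_{i+n-1})$ and $\Sigma=[1]+\cdots+[n+1]$. Then $(f\circ_ig)([r];a_1,\ldots,a_{m+n-1})$, $[r]\in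 C_{m+n-1}$, equals - $f([r];a_1,\ldots,a_{i-1},g_{\Sigma},a_{i+n},\ldots,a_{m+n-1})$ if $1\le r\le i-1$; - $f([i];a_1,\ldots,a_{i-1},g_{[r-i+1]},a_{i+n},\ldots,a_{m+n-1})$ if $i\le r\le i+n-1$; - $f([r-n+1];a_1,\ldots,a_{i-1},g_{\Sigma},a_{i+n},\ldots,a_{m+n-1})$ if $i+n\le r\le m+n-1$; - $f([i];a_1,\ldots,a_{i-1},g_{[n+1]},a_{i+n},\ldots,a_{m+n-1})+f([m+1];a_1,\ldots,a_{i-1},g_{\Sigma},a_{i+n},\ldots,a_{m+n-1})$ if $r=m+n$ (only when $m+n-1\ge2$). A triple of bilinear operations $(\prec_i,\succ_i,\curlyvee_i)$ on $A$ is identified with $\pi_i\in\mathcal O_A(2)$ via $\pi_i([1];a,b)=a\prec_ib$, $\pi_i([2];a,b)=a\succ_ib$, $\pi_i([3];a,b)=a\curlyvee_ib$; $\pi$ denotes the element for $(\prec,\succ,\curlyvee)$, which satisfies $\pi\circ_1\pi=\pi\circ_2\pi$. The cohomology $H^\bullet_{\mathrm{NS}}(A,A)$ of $A$ is that of the complex $\{\mathcal O_A(n)\}_{n\ge1}$ with differential $$\delta_\pi(f)=(-1)^{n-1}\Big[\sum_{i=1}^2(-1)^{(i-1)(n-1)}\pi\circ_if-(-1)^{n-1}\sum_{i=1}^n(-1)^{i-1}f\circ_i\pi\Big],\quad f\in\mathcal O_A(n).$$ A formal one-parameter deformation of $A$ consists of formal sums $\prec_t=\sum_{i\ge0}t^i\prec_i$,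 $\succ_t=\sum_{i\ge0}t^i\succ_i$, $\curlyvee_t=\sum_{i\ge0}t^i\curlyvee_i$ of bilinear maps on $A$ with $\prec_0=\prec$, $\succ_0=\succ$, $\curlyvee_0=\curlyvee$ such that $(A[[t]],\prec_t,\succ_t,\curlyvee_t)$ is an NS-algebra over $\mathbb K[[t]]$. Two deformations $(\prec_t,\succ_t,\curlyvee_t)$, $(\prec'_t,\succ'_t,\curlyvee'_t)$ are equivalent if there is a formal isomorphism $\Phi_t=\sum_{i\ge0}t^i\Phi_i:A[[t]]\to A[[t]]$ with $\Phi_0=\mathrm{id}_A$ ($\Phi_i:A\to A$ linear) that is a morphism of NS-algebras from the first to the second. *)

theory Defs
  imports "HOL-Computational_Algebra.Formal_Power_Series"
begin

text \<open>NS-algebras are set up over a commutative ring, because deformations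
  are NS-algebras over the ring of formal power series.\<close>

definition bilinear_op :: "('k::comm_ring_1 \<Rightarrow> 'a::ab_group_add \<Rightarrow> 'a) \<Rightarrow> ('a \<Rightarrow> 'a \<Rightarrow> 'a) \<Rightarrow> bool" where
  "bilinear_op scale b \<longleftrightarrow>
     (\<forall>y. module_hom scale scale (\<lambda>x. b x y)) \<and> (\<forall>x. module_hom scale scale (\<lambda>y. b x y))"

locale ns_algebra = module scale
  for scale :: "'k::comm_ring_1 \<Rightarrow> 'a::ab_group_add \<Rightarrow> 'a" +
  fixes prec :: "'a \<Rightarrow> 'a \<Rightarrow> 'a" (infixl "\<prec>" 70)
    and succ :: "'a \<Rightarrow> 'a \<Rightarrow> 'a" (infixl "\<succ>" 70)
    and vee :: "'a \<Rightarrow> 'a \<Rightarrow> 'a" (infixl "\<curlyvee>" 70)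
  assumes bilinear_prec: "bilinear_op scale (\<prec>)"
    and bilinear_succ: "bilinear_op scale (\<succ>)"
    and bilinear_vee: "bilinear_op scale (\<curlyvee>)"
    and ns1: "(a \<prec> b) \<prec> c = a \<prec> (b \<prec> c + b \<succ> c + b \<curlyvee> c)"
    and ns2: "(a \<succ> b) \<prec> c = a \<succ> (b \<prec> c)"
    and ns3: "(a \<prec> b + a \<succ> b + a \<curlyvee> b) \<succ> c = a \<succ> (b \<succ> c)"
    and ns4: "(a \<curlyvee> b) \<prec> c + (a \<prec> b + a \<succ> b + a \<curlyvee> b) \<curlyvee> c
              = a \<succ> (b \<curlyvee> c) + a \<curlyvee> (b \<prec> c + b \<succ> c + b \<curlyvee> c)"

definition ns_morphism ::
  "('k::comm_ring_1 \<Rightarrow> 'a::ab_group_add \<Rightarrow> 'a) \<Rightarrow> ('a \<Rightarrow> 'a \<Rightarrow> 'a) \<Rightarrow> ('a \<Rightarrow> 'a \<Rightarrow> 'a) \<Rightarrow> ('a \<Rightarrow> 'a \<Rightarrow> 'a) \<Rightarrow>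
   ('k \<Rightarrow> 'b::ab_group_add \<Rightarrow> 'b) \<Rightarrow> ('b \<Rightarrow> 'b \<Rightarrow> 'b) \<Rightarrow> ('b \<Rightarrow> 'b \<Rightarrow> 'b) \<Rightarrow> ('b \<Rightarrow> 'b \<Rightarrow> 'b) \<Rightarrow>
   ('a \<Rightarrow> 'b) \<Rightarrow> bool" where
  "ns_morphism scale pr su ve scale' pr' su' ve' f \<longleftrightarrow>
     module_hom scale scale' f \<and>
     (\<forall>x y. f (pr x y) = pr' (f x) (f y)) \<and>
     (\<forall>x y. f (su x y) = su' (f x) (f y)) \<and>
     (\<forall>x y. f (ve x y) = ve' (f x) (f y))"

text \<open>A linear map from the tensor product of the free space on \<open>ns_C n\<close> with
  the \<open>n\<close>-th tensor power of \<open>A\<close> is represented by the family \<open>f r xs\<close> of its values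
  on the basis elements \<open>r\<close> and on lists \<open>xs\<close> of length \<open>n\<close>, multilinear in \<open>xs\<close>.
  Values at all other arguments are \<open>0\<close>, so that equality of cochains is equality of
  functions; this also provides the convention that \<open>f 2\<close> is \<open>0\<close> for \<open>f\<close> of arity \<open>1\<close>.\<close>

type_synonym 'a cochain = "nat \<Rightarrow> 'a list \<Rightarrow> 'a"

definition ns_C :: "nat \<Rightarrow> nat set" where
  "ns_C n = (if n = 1 then {1} else {1..n + 1})"

definition ns_cochains :: "('k::comm_ring_1 \<Rightarrow> 'a::ab_group_add \<Rightarrow> 'a) \<Rightarrow> nat \<Rightarrow> 'a cochain set" where
  "ns_cochains scale n = {f.
     (\<forall>r\<in>ns_C n. \<forall>xs i. length xs = n \<longrightarrow> i < n \<longrightarrow>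
        module_hom scale scale (\<lambda>x. f r (xs[i := x]))) \<and>
     (\<forall>r xs. r \<notin> ns_C n \<or> length xs \<noteq> n \<longrightarrow> f r xs = 0)}"

text \<open>\<open>ns_comp m n i f g\<close> is the partial composition of \<open>f\<close> (arity \<open>m\<close>) with
  \<open>g\<close> (arity \<open>n\<close>) in the \<open>i\<close>-th slot, \<open>1 \<le> i \<le> m\<close>.\<close>

definition ns_comp :: "nat \<Rightarrow> nat \<Rightarrow> nat \<Rightarrow> 'a::ab_group_add cochain \<Rightarrow> 'a cochain \<Rightarrow> 'a cochain" where
  "ns_comp m n i f g = (\<lambda>r xs.
     if r \<in> ns_C (m + n - 1) \<and> length xs = m + n - 1 then
       let ys = take n (drop (i - 1) xs);
           g\<Sigma> = (\<Sum>s = 1..n + 1. g s ys);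
           F = (\<lambda>q y. f q (take (i - 1) xs @ [y] @ drop (i - 1 + n) xs))
       in if r \<le> i - 1 then F r g\<Sigma>
          else if r \<le> i + n - 1 then F i (g (r - i + 1) ys)
          else if r \<le> m + n - 1 then F (r - n + 1) g\<Sigma>
          else F i (g (n + 1) ys) + F (m + 1) g\<Sigma>
     else 0)"

definition ns_elem :: "('a::ab_group_add \<Rightarrow> 'a \<Rightarrow> 'a) \<Rightarrow> ('a \<Rightarrow> 'a \<Rightarrow> 'a) \<Rightarrow> ('a \<Rightarrow> 'a \<Rightarrow> 'a) \<Rightarrow> 'a cochain" where
  "ns_elem pr su ve = (\<lambda>r xs. case xs of
       [a, b] \<Rightarrow> (if r = 1 then pr a b else if r = 2 then su a b else if r = 3 then ve a b else 0)
     | _ \<Rightarrow> 0)"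

definition ns_delta :: "('k::comm_ring_1 \<Rightarrow> 'a::ab_group_add \<Rightarrow> 'a) \<Rightarrow> 'a cochain \<Rightarrow> nat \<Rightarrow> 'a cochain \<Rightarrow> 'a cochain" where
  "ns_delta scale \<pi> n f = (\<lambda>r xs. scale ((-1) ^ (n - 1))
     ((\<Sum>i = 1..2. scale ((-1) ^ ((i - 1) * (n - 1))) (ns_comp 2 n i \<pi> f r xs))
      - scale ((-1) ^ (n - 1))
          (\<Sum>i = 1..n. scale ((-1) ^ (i - 1)) (ns_comp n 2 i f \<pi> r xs))))"

definition ns_cocycles :: "('k::comm_ring_1 \<Rightarrow> 'a::ab_group_add \<Rightarrow> 'a) \<Rightarrow> 'a cochain \<Rightarrow> nat \<Rightarrow> 'a cochain set" where
  "ns_cocycles scale \<pi> n = {f \<in> ns_cochains scale n. ns_delta scale \<pi> n f = (\<lambda>r xs. 0)}"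

text \<open>The complex starts in degree \<open>1\<close>, so the only coboundary in degree \<open>1\<close> is \<open>0\<close>.\<close>

definition ns_coboundaries :: "('k::comm_ring_1 \<Rightarrow> 'a::ab_group_add \<Rightarrow> 'a) \<Rightarrow> 'a cochain \<Rightarrow> nat \<Rightarrow> 'a cochain set" where
  "ns_coboundaries scale \<pi> n =
     (if n \<le> 1 then {\<lambda>r xs. 0} else ns_delta scale \<pi> (n - 1) ` ns_cochains scale (n - 1))"

definition ns_cohomologous :: "('k::comm_ring_1 \<Rightarrow> 'a::ab_group_add \<Rightarrow> 'a) \<Rightarrow> 'a cochain \<Rightarrow> nat \<Rightarrow> 'a cochain rel" where
  "ns_cohomologous scale \<pi> n = {(f, g).
     f \<in> ns_cocycles scale \<pi> n \<and> g \<in> ns_cocycles scale \<pi> n \<and>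
     (\<lambda>r xs. f r xs - g r xs) \<in> ns_coboundaries scale \<pi> n}"

definition ns_cohomology :: "('k::comm_ring_1 \<Rightarrow> 'a::ab_group_add \<Rightarrow> 'a) \<Rightarrow> 'a cochain \<Rightarrow> nat \<Rightarrow> 'a cochain set set" where
  "ns_cohomology scale \<pi> n = ns_cocycles scale \<pi> n // ns_cohomologous scale \<pi> n"

definition ns_class :: "('k::comm_ring_1 \<Rightarrow> 'a::ab_group_add \<Rightarrow> 'a) \<Rightarrow> 'a cochain \<Rightarrow> nat \<Rightarrow> 'a cochain \<Rightarrow> 'a cochain set" where
  "ns_class scale \<pi> n f = ns_cohomologous scale \<pi> n `` {f}"

text \<open>\<open>A[[t]]\<close> is the type \<open>'a fps\<close>, used only as an additive group; the next three
  definitions give its \<open>K[[t]]\<close>-module structure and the extensions to it of formal sums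
  of bilinear and of linear maps on \<open>A\<close>.\<close>

definition fps_scale :: "('k::comm_ring_1 \<Rightarrow> 'a::ab_group_add \<Rightarrow> 'a) \<Rightarrow> 'k fps \<Rightarrow> 'a fps \<Rightarrow> 'a fps" where
  "fps_scale scale c x = Abs_fps (\<lambda>n. \<Sum>i\<le>n. scale (fps_nth c i) (fps_nth x (n - i)))"

definition fps_bilin :: "(nat \<Rightarrow> 'a::ab_group_add \<Rightarrow> 'a \<Rightarrow> 'a) \<Rightarrow> 'a fps \<Rightarrow> 'a fps \<Rightarrow> 'a fps" where
  "fps_bilin b x y = Abs_fps (\<lambda>n. \<Sum>i\<le>n. \<Sum>j\<le>n - i. b i (fps_nth x j) (fps_nth y (n - i - j)))"

definition fps_lin :: "(nat \<Rightarrow> 'a::ab_group_add \<Rightarrow> 'a) \<Rightarrow> 'a fps \<Rightarrow> 'a fps" where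
  "fps_lin \<Phi> x = Abs_fps (\<lambda>n. \<Sum>i\<le>n. \<Phi> i (fps_nth x (n - i)))"

definition ns_deformation ::
  "('k::comm_ring_1 \<Rightarrow> 'a::ab_group_add \<Rightarrow> 'a) \<Rightarrow> ('a \<Rightarrow> 'a \<Rightarrow> 'a) \<Rightarrow> ('a \<Rightarrow> 'a \<Rightarrow> 'a) \<Rightarrow> ('a \<Rightarrow> 'a \<Rightarrow> 'a) \<Rightarrow>
   (nat \<Rightarrow> 'a \<Rightarrow> 'a \<Rightarrow> 'a) \<Rightarrow> (nat \<Rightarrow> 'a \<Rightarrow> 'a \<Rightarrow> 'a) \<Rightarrow> (nat \<Rightarrow> 'a \<Rightarrow> 'a \<Rightarrow> 'a) \<Rightarrow> bool" where
  "ns_deformation scale pr su ve prt sut vet \<longleftrightarrow>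
     (\<forall>i. bilinear_op scale (prt i) \<and> bilinear_op scale (sut i) \<and> bilinear_op scale (vet i)) \<and>
     prt 0 = pr \<and> sut 0 = su \<and> vet 0 = ve \<and>
     ns_algebra (fps_scale scale) (fps_bilin prt) (fps_bilin sut) (fps_bilin vet)"

definition ns_deformation_equiv ::
  "('k::comm_ring_1 \<Rightarrow> 'a::ab_group_add \<Rightarrow> 'a) \<Rightarrow>
   (nat \<Rightarrow> 'a \<Rightarrow> 'a \<Rightarrow> 'a) \<Rightarrow> (nat \<Rightarrow> 'a \<Rightarrow> 'a \<Rightarrow> 'a) \<Rightarrow> (nat \<Rightarrow> 'a \<Rightarrow> 'a \<Rightarrow> 'a) \<Rightarrow>
   (nat \<Rightarrow> 'a \<Rightarrow> 'a \<Rightarrow> 'a) \<Rightarrow> (nat \<Rightarrow> 'a \<Rightarrow> 'a \<Rightarrow> 'a) \<Rightarrow> (nat \<Rightarrow> 'a \<Rightarrow> 'a \<Rightarrow> 'a) \<Rightarrow> bool" where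
  "ns_deformation_equiv scale prt sut vet prt' sut' vet' \<longleftrightarrow>
     (\<exists>\<Phi>. (\<forall>i. module_hom scale scale (\<Phi> i)) \<and> \<Phi> 0 = id \<and> bij (fps_lin \<Phi>) \<and>
        ns_morphism (fps_scale scale) (fps_bilin prt) (fps_bilin sut) (fps_bilin vet)
                    (fps_scale scale) (fps_bilin prt') (fps_bilin sut') (fps_bilin vet')
                    (fps_lin \<Phi>))"

end

theory Submission
  imports Defs
begin

text \<open>
  Both claims are read off from coefficients of \<open>t\<close> at constant power series. In the four
  NS-algebra laws these coefficients say \<open>\<pi>\<^sub>1 \<circ>\<^sub>1 \<pi> + \<pi> \<circ>\<^sub>1 \<pi>\<^sub>1 = \<pi>\<^sub>1 \<circ>\<^sub>2 \<pi> + \<pi> \<circ>\<^sub>2 \<pi>\<^sub>1\<close>,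
  which is the cocycle condition. If \<open>\<Phi>\<^sub>t\<close> is an equivalence of deformations, the
  coefficient of \<open>t\<close> in its morphism conditions says \<open>\<pi>\<^sub>1 - \<pi>'\<^sub>1 = \<delta>\<^sub>\<pi> \<Phi>\<^sub>1\<close>.
\<close>

section \<open>Coefficients of degree 0 and 1 in deformations and equivalences\<close>

lemma bilinear_op_diff_zero:
  assumes "bilinear_op scale b"
  shows "b (x - x') y = b x y - b x' y" "b x (y - y') = b x y - b x y'"
    "b 0 y = 0" "b x 0 = 0"
proof -
  interpret l: module_hom scale scale "\<lambda>x. b x y" for y
    using assms by (simp add: bilinear_op_def)
  interpret r: module_hom scale scale "b x" for x
    using assms by (simp add: bilinear_op_def)
  show "b (x - x') y = b x y - b x' y" "b 0 y = 0" by (rule l.diff l.zero)+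
  show "b x (y - y') = b x y - b x y'" "b x 0 = 0" by (rule r.diff r.zero)+
qed

lemma fps_bilin_nth_0: "fps_nth (fps_bilin b x y) 0 = b 0 (fps_nth x 0) (fps_nth y 0)"
  by (simp add: fps_bilin_def)

lemma fps_bilin_nth_1:
  "fps_nth (fps_bilin b x y) 1 =
     b 0 (fps_nth x 0) (fps_nth y 1) + b 0 (fps_nth x 1) (fps_nth y 0) + b 1 (fps_nth x 0) (fps_nth y 0)"
  by (simp add: fps_bilin_def)

lemma fps_lin_nth_0: "fps_nth (fps_lin \<Phi> x) 0 = \<Phi> 0 (fps_nth x 0)"
  by (simp add: fps_lin_def)

lemma fps_lin_nth_1: "fps_nth (fps_lin \<Phi> x) 1 = \<Phi> 0 (fps_nth x 1) + \<Phi> 1 (fps_nth x 0)"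
  by (simp add: fps_lin_def)

lemmas fps_nth_01 = fps_bilin_nth_0 fps_bilin_nth_1 fps_lin_nth_0 fps_lin_nth_1

text \<open>At constant series, the coefficient of \<open>t\<close> in a law collects the terms in
  which exactly one of the two nested operations has index 1. The conclusions follow the order of
  the basis elements 1, 2, 3, 4 of \<open>ns_C 3\<close>.\<close>

lemma ns_deformation_linear_term:
  fixes scale :: "'k::comm_ring_1 \<Rightarrow> 'a::ab_group_add \<Rightarrow> 'a"
  assumes "ns_deformation scale pr su ve prt sut vet"
  defines "star \<equiv> \<lambda>x y. pr x y + su x y + ve x y"
    and "star1 \<equiv> \<lambda>x y. prt 1 x y + sut 1 x y + vet 1 x y"
  shows "pr (prt 1 a b) c + prt 1 (pr a b) c = pr a (star1 b c) + prt 1 a (star b c)"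
    and "pr (sut 1 a b) c + prt 1 (su a b) c = su a (prt 1 b c) + sut 1 a (pr b c)"
    and "su (star1 a b) c + sut 1 (star a b) c = su a (sut 1 b c) + sut 1 a (su b c)"
    and "pr (vet 1 a b) c + prt 1 (ve a b) c + (ve (star1 a b) c + vet 1 (star a b) c)
       = su a (vet 1 b c) + sut 1 a (ve b c) + (ve a (star1 b c) + vet 1 a (star b c))"
proof -
  note d = assms(1)[unfolded ns_deformation_def]
  have [simp]: "prt 0 = pr" "sut 0 = su" "vet 0 = ve" using d by auto
  have "bilinear_op scale pr" "bilinear_op scale su" "bilinear_op scale ve" using d by metis+
  \<comment> \<open>A constant series has coefficient 0 at \<open>t\<close>; these rules remove the
    products with that coefficient.\<close>
  note [simp] = this[THEN bilinear_op_diff_zero(3)] this[THEN bilinear_op_diff_zero(4)]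
  interpret t: ns_algebra "fps_scale scale" "fps_bilin prt" "fps_bilin sut" "fps_bilin vet"
    using d by simp
  let ?c = "\<lambda>a::'a. fps_const a"
  \<comment> \<open>Each law is compared in degree 1. Below, the coefficient rules are restated with
    \<open>Suc 0\<close>, the form to which the simplifier brings the index
    \<open>1\<close>.\<close>
  note coeff = arg_cong[where f = "\<lambda>x. fps_nth x 1"]
  show "pr (prt 1 a b) c + prt 1 (pr a b) c = pr a (star1 b c) + prt 1 a (star b c)"
    using coeff[OF t.ns1[of "?c a" "?c b" "?c c"]]
    by (simp add: fps_nth_01[unfolded One_nat_def] star_def star1_def)
  show "pr (sut 1 a b) c + prt 1 (su a b) c = su a (prt 1 b c) + sut 1 a (pr b c)"
    using coeff[OF t.ns2[of "?c a" "?c b" "?c c"]]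
    by (simp add: fps_nth_01[unfolded One_nat_def] star_def star1_def)
  show "su (star1 a b) c + sut 1 (star a b) c = su a (sut 1 b c) + sut 1 a (su b c)"
    using coeff[OF t.ns3[of "?c a" "?c b" "?c c"]]
    by (simp add: fps_nth_01[unfolded One_nat_def] star_def star1_def)
  show "pr (vet 1 a b) c + prt 1 (ve a b) c + (ve (star1 a b) c + vet 1 (star a b) c)
       = su a (vet 1 b c) + sut 1 a (ve b c) + (ve a (star1 b c) + vet 1 a (star b c))"
    using coeff[OF t.ns4[of "?c a" "?c b" "?c c"]]
    by (simp add: fps_nth_01[unfolded One_nat_def] star_def star1_def)
qed

text \<open>An equivalence is the identity modulo \<open>t\<close>, so it changes the linear terms
  only by the failure of \<open>\<Phi> 1\<close> to be a derivation. This form matches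
  \<open>ns_delta_linear_cochain\<close>.\<close>

lemma ns_deformation_equiv_linear_term:
  fixes scale :: "'k::comm_ring_1 \<Rightarrow> 'a::ab_group_add \<Rightarrow> 'a"
  assumes "ns_deformation scale pr su ve prt sut vet"
    and "ns_deformation scale pr su ve prt' sut' vet'"
    and "ns_deformation_equiv scale prt sut vet prt' sut' vet'"
  obtains \<phi> where "module_hom scale scale \<phi>"
    and "\<And>a b. prt 1 a b - prt' 1 a b = pr (\<phi> a) b + pr a (\<phi> b) - \<phi> (pr a b)"
    and "\<And>a b. sut 1 a b - sut' 1 a b = su (\<phi> a) b + su a (\<phi> b) - \<phi> (su a b)"
    and "\<And>a b. vet 1 a b - vet' 1 a b = ve (\<phi> a) b + ve a (\<phi> b) - \<phi> (ve a b)"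
proof -
  from assms(3) obtain \<Phi> where lin: "\<forall>i. module_hom scale scale (\<Phi> i)" and [simp]: "\<Phi> 0 = id"
    and mor: "ns_morphism (fps_scale scale) (fps_bilin prt) (fps_bilin sut) (fps_bilin vet)
                    (fps_scale scale) (fps_bilin prt') (fps_bilin sut') (fps_bilin vet') (fps_lin \<Phi>)"
    by (auto simp: ns_deformation_equiv_def)
  have [simp]: "prt 0 = pr" "sut 0 = su" "vet 0 = ve" "prt' 0 = pr" "sut' 0 = su" "vet' 0 = ve"
    using assms(1,2) by (auto simp: ns_deformation_def)
  have "bilinear_op scale pr" "bilinear_op scale su" "bilinear_op scale ve"
    using assms(1) unfolding ns_deformation_def by metis+
  note [simp] = this[THEN bilinear_op_diff_zero(3)] this[THEN bilinear_op_diff_zero(4)]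
  \<comment> \<open>One argument for all three operations: as \<open>\<Phi> 0 = id\<close>, the
    coefficient of \<open>t\<close> at constants reads \<open>b 1 a c + \<Phi> 1 (b 0 a c) = b' 1 a
    c + b 0 (\<Phi> 1 a) c + b 0 a (\<Phi> 1 c)\<close>.\<close>
  have *: "b 1 a c - b' 1 a c = b 0 (\<Phi> 1 a) c + b 0 a (\<Phi> 1 c) - \<Phi> 1 (b 0 a c)"
    if "\<forall>x y. fps_lin \<Phi> (fps_bilin b x y) = fps_bilin b' (fps_lin \<Phi> x) (fps_lin \<Phi> y)"
      "b' 0 = b 0" "\<And>y. b 0 0 y = 0" "\<And>x. b 0 x 0 = 0" for b b' a c
    using arg_cong[OF that(1)[rule_format, of "fps_const a" "fps_const c"], of "\<lambda>x. fps_nth x 1"] that(2-)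
      module_hom.zero[OF lin[rule_format, of 1]]
    by (simp add: fps_nth_01[unfolded One_nat_def] algebra_simps)
  show thesis
    by (rule that[of "\<Phi> 1"])
      (use lin mor *[of prt prt'] *[of sut sut'] *[of vet vet'] in \<open>simp_all add: ns_morphism_def\<close>)
qed

section \<open>Triples of bilinear operations as 2-cochains\<close>

lemma ns_elem_simps [simp]:
  "ns_elem pr su ve (Suc 0) [a, b] = pr a b"
  "ns_elem pr su ve 2 [a, b] = su a b"
  "ns_elem pr su ve (Suc (Suc 0)) [a, b] = su a b"
  "ns_elem pr su ve 3 [a, b] = ve a b"
  by (simp_all add: ns_elem_def)

lemma ns_elem_eq_0:
  assumes "r \<notin> ns_C 2 \<or> length xs \<noteq> 2"
  shows "ns_elem pr su ve r xs = 0"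
  using assms by (auto simp: ns_elem_def ns_C_def split: list.splits)

text \<open>Lets a difference of two linear terms be compared, as a single triple, with the
  coboundary of a linear map.\<close>

lemma ns_elem_diff:
  "ns_elem pr su ve r xs - ns_elem pr' su' ve' r xs =
   ns_elem (\<lambda>a b. pr a b - pr' a b) (\<lambda>a b. su a b - su' a b) (\<lambda>a b. ve a b - ve' a b) r xs"
  by (simp add: ns_elem_def split: list.splits)

lemma ns_elem_in_cochains:
  assumes "bilinear_op scale pr" "bilinear_op scale su" "bilinear_op scale ve"
  shows "ns_elem pr su ve \<in> ns_cochains scale 2"
proof -
  have "module_hom scale scale (\<lambda>x. ns_elem pr su ve r (xs[i := x]))"
    if r: "r \<in> ns_C 2" and "length xs = 2" "i < 2" for r xs i
  proof -
    obtain a b where xs: "xs = [a, b]"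
      using \<open>length xs = 2\<close> by (auto simp: length_Suc_conv numeral_2_eq_2)
    have "r = 1 \<or> r = 2 \<or> r = 3" "i = 0 \<or> i = 1" using r \<open>i < 2\<close> by (auto simp: ns_C_def)
    then show ?thesis using assms by (auto simp: xs bilinear_op_def)
  qed
  then show ?thesis by (auto simp: ns_cochains_def ns_elem_eq_0)
qed

section \<open>The differential in degrees 1 and 2, and the cocycle condition\<close>

lemma ns_delta_1:
  assumes "module scale"
  shows "ns_delta scale \<pi> 1 f r xs = ns_comp 2 1 1 \<pi> f r xs + ns_comp 2 1 2 \<pi> f r xs - ns_comp 1 2 1 f \<pi> r xs"
proof -
  interpret module scale by fact
  have "{Suc 0..2} = {1, 2}" by auto
  then show ?thesis by (simp add: ns_delta_def)
qed

text \<open>For arity 2 the signs separate the two slots: the result is the linearisation at \<pi>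
  in direction \<open>f\<close> of the second-slot composition minus that of the first-slot
  one.\<close>

lemma ns_delta_2:
  assumes "module scale"
  shows "ns_delta scale \<pi> 2 f r xs =
    ns_comp 2 2 2 \<pi> f r xs + ns_comp 2 2 2 f \<pi> r xs - (ns_comp 2 2 1 \<pi> f r xs + ns_comp 2 2 1 f \<pi> r xs)"
proof -
  interpret module scale by fact
  have "{Suc 0..2} = {1, 2}" by auto
  then show ?thesis by (simp add: ns_delta_def algebra_simps)
qed

text \<open>For a triple, the argument \<open>g\<Sigma>\<close> in \<open>ns_comp\<close> is the
  total product.\<close>

lemma ns_elem_sum:
  "(\<Sum>s = Suc 0..3. ns_elem pr su ve s [a, b]) = pr a b + su a b + ve a b"
  by (simp add: numeral_3_eq_3 numeral_2_eq_2 ns_elem_def)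

lemma ns_comp_outside:
  assumes "r \<notin> ns_C (m + n - 1) \<or> length xs \<noteq> m + n - 1"
  shows "ns_comp m n i f g r xs = 0"
  using assms by (auto simp: ns_comp_def)

text \<open>When the two triples coincide, these are the left-hand sides of the four NS-algebra
  laws, and \<open>ns_comp_elem_2\<close> gives the right-hand sides. Distinct triples give the
  mixed terms of the linearised laws.\<close>

lemma ns_comp_elem_1:
  "ns_comp 2 2 1 (ns_elem pr su ve) (ns_elem pr' su' ve') 1 [a, b, c] = pr (pr' a b) c"
  "ns_comp 2 2 1 (ns_elem pr su ve) (ns_elem pr' su' ve') 2 [a, b, c] = pr (su' a b) c"
  "ns_comp 2 2 1 (ns_elem pr su ve) (ns_elem pr' su' ve') 3 [a, b, c] = su (pr' a b + su' a b + ve' a b) c"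
  "ns_comp 2 2 1 (ns_elem pr su ve) (ns_elem pr' su' ve') 4 [a, b, c] =
     pr (ve' a b) c + ve (pr' a b + su' a b + ve' a b) c"
  by (simp_all add: ns_comp_def ns_C_def ns_elem_sum Let_def)

lemma ns_comp_elem_2:
  "ns_comp 2 2 2 (ns_elem pr su ve) (ns_elem pr' su' ve') 1 [a, b, c] = pr a (pr' b c + su' b c + ve' b c)"
  "ns_comp 2 2 2 (ns_elem pr su ve) (ns_elem pr' su' ve') 2 [a, b, c] = su a (pr' b c)"
  "ns_comp 2 2 2 (ns_elem pr su ve) (ns_elem pr' su' ve') 3 [a, b, c] = su a (su' b c)"
  "ns_comp 2 2 2 (ns_elem pr su ve) (ns_elem pr' su' ve') 4 [a, b, c] =
     su a (ve' b c) + ve a (pr' b c + su' b c + ve' b c)"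
  by (simp_all add: ns_comp_def ns_C_def ns_elem_sum Let_def)

lemma ns_deformation_cocycle:
  fixes scale :: "'k::comm_ring_1 \<Rightarrow> 'a::ab_group_add \<Rightarrow> 'a"
  assumes "module scale" and d: "ns_deformation scale pr su ve prt sut vet"
  shows "ns_elem (prt 1) (sut 1) (vet 1) \<in> ns_cocycles scale (ns_elem pr su ve) 2"
proof -
  let ?f = "ns_elem (prt 1) (sut 1) (vet 1)" and ?p = "ns_elem pr su ve"
  have "ns_delta scale ?p 2 ?f r xs = 0" for r xs
  \<comment> \<open>All four compositions have arity 2 + 2 - 1 = 3 and vanish off this domain; on
    it, each of the four values of \<open>r\<close> is one linearised law.\<close>
  proof (cases "r \<in> ns_C 3 \<and> length xs = 3")
    case True
    then obtain a b c where "xs = [a, b, c]"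
      by (auto simp: length_Suc_conv numeral_3_eq_3)
    moreover have "r = 1 \<or> r = 2 \<or> r = 3 \<or> r = 4" using True by (auto simp: ns_C_def)
    ultimately show ?thesis
      using ns_deformation_linear_term[OF d, of a b c]
      by (elim disjE) (simp_all add: ns_delta_2[OF assms(1)] ns_comp_elem_1[unfolded One_nat_def]
        ns_comp_elem_2[unfolded One_nat_def] algebra_simps)
  next
    case False
    then show ?thesis by (subst ns_delta_2[OF assms(1)]) (simp add: ns_comp_outside)
  qed
  moreover have "?f \<in> ns_cochains scale 2"
    using d by (intro ns_elem_in_cochains) (simp_all add: ns_deformation_def)
  ultimately show ?thesis by (auto simp: ns_cocycles_def fun_eq_iff)
qed

section \<open>Linear maps as 1-cochains, and their coboundaries\<close>

definition linear_cochain :: "('a::ab_group_add \<Rightarrow> 'a) \<Rightarrow> 'a cochain" where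
  "linear_cochain \<phi> = (\<lambda>r xs. if r = 1 \<and> length xs = 1 then \<phi> (hd xs) else 0)"

text \<open>Since \<open>ns_C 1\<close> has a single element, a 1-cochain carries no more data than
  one linear endomorphism of the space.\<close>

lemma ns_cochains_1: "ns_cochains scale 1 = linear_cochain ` {\<phi>. module_hom scale scale \<phi>}"
proof (intro equalityI subsetI)
  fix f assume "f \<in> ns_cochains scale 1"
  then have lin: "\<forall>xs. length xs = 1 \<longrightarrow> module_hom scale scale (\<lambda>x. f 1 (xs[0 := x]))"
    and zero: "\<And>r xs. r \<noteq> 1 \<or> length xs \<noteq> 1 \<Longrightarrow> f r xs = 0"
    by (simp_all add: ns_cochains_def ns_C_def)
  have "module_hom scale scale (\<lambda>x. f 1 [x])"
    \<comment> \<open>Any one-element list would do: its entry is overwritten.\<close>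
    using lin[rule_format, of "[0]"] by simp
  moreover have "f = linear_cochain (\<lambda>x. f 1 [x])"
  proof (intro ext)
    fix r xs
    show "f r xs = linear_cochain (\<lambda>x. f 1 [x]) r xs"
    proof (cases "r = 1 \<and> length xs = 1")
      case True
      then show ?thesis by (cases xs) (simp_all add: linear_cochain_def)
    next
      case False
      then show ?thesis using zero[of r xs] by (simp only: linear_cochain_def if_False) blast
    qed
  qed
  ultimately show "f \<in> linear_cochain ` {\<phi>. module_hom scale scale \<phi>}"
    by blast
next
  fix f assume "f \<in> linear_cochain ` {\<phi>. module_hom scale scale \<phi>}"
  then obtain \<phi> where f: "f = linear_cochain \<phi>" and \<phi>: "module_hom scale scale \<phi>"
    by blast
  have "(\<lambda>x. f 1 (xs[0 := x])) = \<phi>" if "length xs = 1" for xs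
    using that by (cases xs) (simp_all add: f linear_cochain_def)
  with \<phi> have "\<forall>r\<in>{1}. \<forall>xs i. length xs = 1 \<longrightarrow> i < 1 \<longrightarrow> module_hom scale scale (\<lambda>x. f r (xs[i := x]))"
    by simp
  moreover have "\<forall>r xs. r \<notin> {1} \<or> length xs \<noteq> 1 \<longrightarrow> f r xs = 0"
    by (simp add: f linear_cochain_def)
  ultimately show "f \<in> ns_cochains scale 1"
    unfolding ns_cochains_def ns_C_def by simp
qed

lemma linear_cochain_simps [simp]:
  "linear_cochain \<phi> (Suc 0) [a] = \<phi> a"
  "r \<noteq> Suc 0 \<Longrightarrow> linear_cochain \<phi> r xs = 0"
  by (simp_all add: linear_cochain_def)

text \<open>In arity 1, \<open>g\<Sigma>\<close> also runs over the index 2, where the cochain is 0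
  by convention.\<close>

lemma linear_cochain_sum: "(\<Sum>s = Suc 0..2. linear_cochain \<phi> s [a]) = \<phi> a"
  by (simp add: numeral_2_eq_2)

text \<open>At index 3 the composition has a second summand \<open>pr 0 b\<close>, arising from the
  value 0 of the linear cochain at index 2; bilinearity of \<open>pr\<close> removes it.\<close>

lemma ns_comp_elem_linear_1:
  assumes "bilinear_op scale pr" "bilinear_op scale su"
  shows "ns_comp 2 1 1 (ns_elem pr su ve) (linear_cochain \<phi>) 1 [a, b] = pr (\<phi> a) b"
    and "ns_comp 2 1 1 (ns_elem pr su ve) (linear_cochain \<phi>) 2 [a, b] = su (\<phi> a) b"
    and "ns_comp 2 1 1 (ns_elem pr su ve) (linear_cochain \<phi>) 3 [a, b] = ve (\<phi> a) b"
  using bilinear_op_diff_zero(3)[OF assms(1)]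
  by (simp_all add: ns_comp_def ns_C_def linear_cochain_sum Let_def)

lemma ns_comp_elem_linear_2:
  assumes "bilinear_op scale pr" "bilinear_op scale su"
  shows "ns_comp 2 1 2 (ns_elem pr su ve) (linear_cochain \<phi>) 1 [a, b] = pr a (\<phi> b)"
    and "ns_comp 2 1 2 (ns_elem pr su ve) (linear_cochain \<phi>) 2 [a, b] = su a (\<phi> b)"
    and "ns_comp 2 1 2 (ns_elem pr su ve) (linear_cochain \<phi>) 3 [a, b] = ve a (\<phi> b)"
  \<comment> \<open>In the second slot the extra summand at index 3 is
    \<open>su a 0\<close>.\<close>
  using bilinear_op_diff_zero(4)[OF assms(2)]
  by (simp_all add: ns_comp_def ns_C_def linear_cochain_sum Let_def)

lemma ns_comp_linear_elem:
  "ns_comp 1 2 1 (linear_cochain \<phi>) (ns_elem pr su ve) 1 [a, b] = \<phi> (pr a b)"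
  "ns_comp 1 2 1 (linear_cochain \<phi>) (ns_elem pr su ve) 2 [a, b] = \<phi> (su a b)"
  "ns_comp 1 2 1 (linear_cochain \<phi>) (ns_elem pr su ve) 3 [a, b] = \<phi> (ve a b)"
  by (simp_all add: ns_comp_def ns_C_def Let_def)

text \<open>Composing \<pi> with \<phi> puts \<phi> into one factor, composing \<phi> with \<pi>
  applies it to the product. The coboundary is thus the defect of \<phi> from being a derivation of
  each operation.\<close>

lemma ns_delta_linear_cochain:
  fixes scale :: "'k::comm_ring_1 \<Rightarrow> 'a::ab_group_add \<Rightarrow> 'a"
  assumes "module scale"
    and "bilinear_op scale pr" "bilinear_op scale su" "bilinear_op scale ve"
  shows "ns_delta scale (ns_elem pr su ve) 1 (linear_cochain \<phi>) =
    ns_elem (\<lambda>a b. pr (\<phi> a) b + pr a (\<phi> b) - \<phi> (pr a b))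
            (\<lambda>a b. su (\<phi> a) b + su a (\<phi> b) - \<phi> (su a b))
            (\<lambda>a b. ve (\<phi> a) b + ve a (\<phi> b) - \<phi> (ve a b))"
    (is "?l = ?r")
proof (intro ext)
  fix r xs
  show "?l r xs = ?r r xs"
  proof (cases "r \<in> ns_C 2 \<and> length xs = 2")
    case True
    then obtain a b where "xs = [a, b]"
      by (auto simp: length_Suc_conv numeral_2_eq_2)
    moreover have "r = 1 \<or> r = 2 \<or> r = 3" using True by (auto simp: ns_C_def)
    ultimately show ?thesis
      using assms(2-4)
      by (elim disjE) (simp_all add: ns_delta_1[unfolded One_nat_def, OF assms(1)] ns_comp_linear_elem[unfolded One_nat_def]
        ns_comp_elem_linear_1[unfolded One_nat_def] ns_comp_elem_linear_2[unfolded One_nat_def])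
  next
    case False
    then have "ns_comp m n i f g r xs = 0" if "m + n - 1 = 2" for m n i and f g :: "'a cochain"
      using that by (intro ns_comp_outside) auto
    moreover have "?r r xs = 0"
      using False by (intro ns_elem_eq_0) blast
    ultimately show ?thesis
      by (simp add: ns_delta_1[OF assms(1), unfolded One_nat_def])
  qed
qed

section \<open>2-coboundaries and equality of cohomology classes\<close>

lemma ns_coboundaries_2:
  assumes "module scale"
    and "bilinear_op scale pr" "bilinear_op scale su" "bilinear_op scale ve"
  shows "ns_coboundaries scale (ns_elem pr su ve) 2 =
    (\<lambda>\<phi>. ns_elem (\<lambda>a b. pr (\<phi> a) b + pr a (\<phi> b) - \<phi> (pr a b))
            (\<lambda>a b. su (\<phi> a) b + su a (\<phi> b) - \<phi> (su a b))
            (\<lambda>a b. ve (\<phi> a) b + ve a (\<phi> b) - \<phi> (ve a b))) ` {\<phi>. module_hom scale scale \<phi>}"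
  using ns_delta_linear_cochain[OF assms] ns_cochains_1[of scale]
  by (simp add: ns_coboundaries_def image_image)

text \<open>The derivation defect is additive in the linear map, so the difference of two
  coboundaries comes from \<phi> - \<psi>.\<close>

lemma ns_coboundaries_2_diff:
  assumes "module scale"
    and bil: "bilinear_op scale pr" "bilinear_op scale su" "bilinear_op scale ve"
    and "f \<in> ns_coboundaries scale (ns_elem pr su ve) 2"
    and "g \<in> ns_coboundaries scale (ns_elem pr su ve) 2"
  shows "(\<lambda>r xs. f r xs - g r xs) \<in> ns_coboundaries scale (ns_elem pr su ve) 2"
proof -
  obtain \<phi> \<psi> where hom: "module_hom scale scale \<phi>" "module_hom scale scale \<psi>"
    and f: "f = ns_delta scale (ns_elem pr su ve) 1 (linear_cochain \<phi>)"
    and g: "g = ns_delta scale (ns_elem pr su ve) 1 (linear_cochain \<psi>)"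
    using assms(5,6) ns_cochains_1[of scale] by (auto simp: ns_coboundaries_def)
  have "module_hom scale scale (\<lambda>x. \<phi> x - \<psi> x)"
    using hom assms(1) by (intro module_pair.module_hom_sub) (simp_all add: module_pair_def)
  moreover have "(\<lambda>r xs. f r xs - g r xs) =
      ns_delta scale (ns_elem pr su ve) 1 (linear_cochain (\<lambda>x. \<phi> x - \<psi> x))"
    unfolding f g ns_delta_linear_cochain[OF assms(1-4)] ns_elem_diff
    by (simp add: bil[THEN bilinear_op_diff_zero(1)] bil[THEN bilinear_op_diff_zero(2)] algebra_simps)
  ultimately show ?thesis
    using ns_cochains_1[of scale] by (auto simp: ns_coboundaries_def)
qed

text \<open>The two classes are compared element by element: modulo coboundaries, subtracting
  \<open>h\<close> from \<open>f\<close> or from \<open>g\<close> gives the same result.\<close>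

lemma ns_class_2_eqI:
  assumes "module scale"
    and "bilinear_op scale pr" "bilinear_op scale su" "bilinear_op scale ve"
    and fg: "f \<in> ns_cocycles scale (ns_elem pr su ve) 2" "g \<in> ns_cocycles scale (ns_elem pr su ve) 2"
    and B: "(\<lambda>r xs. f r xs - g r xs) \<in> ns_coboundaries scale (ns_elem pr su ve) 2"
  shows "ns_class scale (ns_elem pr su ve) 2 f = ns_class scale (ns_elem pr su ve) 2 g"
proof -
  let ?B = "ns_coboundaries scale (ns_elem pr su ve) 2"
  note diff = ns_coboundaries_2_diff[OF assms(1-4)]
  have "(\<lambda>r xs. g r xs - f r xs) \<in> ?B"
    \<comment> \<open>\<open>g - f\<close> is written as \<open>0 - (f - g)\<close>, with 0 obtained
      as \<open>(f - g) - (f - g)\<close>.\<close>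
    using diff[OF diff[OF B B] B] by simp
  then have "(\<lambda>r xs. f r xs - h r xs) \<in> ?B \<longleftrightarrow> (\<lambda>r xs. g r xs - h r xs) \<in> ?B" for h
    \<comment> \<open>The two directions are \<open>g - h = (f - h) - (f - g)\<close> and
      \<open>f - h = (g - h) - (g - f)\<close>.\<close>
    using diff[OF _ B, of "\<lambda>r xs. f r xs - h r xs"] diff[of "\<lambda>r xs. g r xs - h r xs" "\<lambda>r xs. g r xs - f r xs"]
    by auto
  then show ?thesis using fg by (auto simp: ns_class_def ns_cohomologous_def)
qed

theorem theorem5p7:
  fixes scale :: "'k::field_char_0 \<Rightarrow> 'a::ab_group_add \<Rightarrow> 'a"
    and pr su ve :: "'a \<Rightarrow> 'a \<Rightarrow> 'a"
    and prt sut vet :: "nat \<Rightarrow> 'a \<Rightarrow> 'a \<Rightarrow> 'a"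
  assumes "vector_space scale"
    and "ns_algebra scale pr su ve"
    and "ns_deformation scale pr su ve prt sut vet"
  defines "\<pi> \<equiv> ns_elem pr su ve"
  shows "ns_elem (prt 1) (sut 1) (vet 1) \<in> ns_cocycles scale \<pi> 2
    \<and> ns_class scale \<pi> 2 (ns_elem (prt 1) (sut 1) (vet 1)) \<in> ns_cohomology scale \<pi> 2
    \<and> (\<forall>prt' sut' vet'.
         ns_deformation scale pr su ve prt' sut' vet' \<longrightarrow>
         ns_deformation_equiv scale prt sut vet prt' sut' vet' \<longrightarrow>
         ns_class scale \<pi> 2 (ns_elem (prt' 1) (sut' 1) (vet' 1))
           = ns_class scale \<pi> 2 (ns_elem (prt 1) (sut 1) (vet 1)))"
proof (intro conjI allI impI)
  interpret A: ns_algebra scale pr su ve by fact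
  \<comment> \<open>Stated for an arbitrary deformation, as the primed one needs it too.\<close>
  have cocycle: "ns_elem (prt 1) (sut 1) (vet 1) \<in> ns_cocycles scale \<pi> 2"
    if "ns_deformation scale pr su ve prt sut vet" for prt sut vet
    using ns_deformation_cocycle[OF A.module_axioms that] by (simp only: \<pi>_def)
  show *: "ns_elem (prt 1) (sut 1) (vet 1) \<in> ns_cocycles scale \<pi> 2"
    using assms(3) by (rule cocycle)
  then show "ns_class scale \<pi> 2 (ns_elem (prt 1) (sut 1) (vet 1)) \<in> ns_cohomology scale \<pi> 2"
    by (simp only: ns_class_def ns_cohomology_def quotientI)
  fix prt' sut' vet'
  assume d': "ns_deformation scale pr su ve prt' sut' vet'"
    and e: "ns_deformation_equiv scale prt sut vet prt' sut' vet'"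
  note bil = A.bilinear_prec A.bilinear_succ A.bilinear_vee
  from ns_deformation_equiv_linear_term[OF assms(3) d' e] obtain \<phi>
    where hom: "module_hom scale scale \<phi>"
      and eq: "\<And>a b. prt 1 a b - prt' 1 a b = pr (\<phi> a) b + pr a (\<phi> b) - \<phi> (pr a b)"
        "\<And>a b. sut 1 a b - sut' 1 a b = su (\<phi> a) b + su a (\<phi> b) - \<phi> (su a b)"
        "\<And>a b. vet 1 a b - vet' 1 a b = ve (\<phi> a) b + ve a (\<phi> b) - \<phi> (ve a b)"
    by metis
  \<comment> \<open>The difference of the linear terms is the coboundary of \<phi>, the linear term
    of the equivalence.\<close>
  have "(\<lambda>r xs. ns_elem (prt 1) (sut 1) (vet 1) r xs - ns_elem (prt' 1) (sut' 1) (vet' 1) r xs)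
      \<in> ns_coboundaries scale \<pi> 2"
    unfolding ns_elem_diff eq \<pi>_def ns_coboundaries_2[OF A.module_axioms bil]
    using hom by blast
  from ns_class_2_eqI[OF A.module_axioms bil *[unfolded \<pi>_def] cocycle[OF d', unfolded \<pi>_def] this[unfolded \<pi>_def]]
  show "ns_class scale \<pi> 2 (ns_elem (prt' 1) (sut' 1) (vet' 1))
      = ns_class scale \<pi> 2 (ns_elem (prt 1) (sut 1) (vet 1))"
    by (simp only: \<pi>_def)
qed

end
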